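(* Let $q\in\mathbb{C}$ with $0<|q|<1$ and let $\lambda_1,\dots,\lambda_5\in\mathbb{C}$ satisfy $|\lambda_1\lambda_4|,|\lambda_1\lambda_5|,|\lambda_2\lambda_4|,|\lambda_2\lambda_5|<1$ and $\lambda_1\lambda_2\lambda_3\lambda_4,\ \lambda_2\lambda_3\lambda_4\lambda_5\notin\{q^{-j}:j=0,1,2,\dots\}$. Then $${}_3\phi_2\left[\begin{matrix}\lambda_2\lambda_3,\lambda_2\lambda_4,\lambda_3\lambda_4\\ \lambda_1\lambda_2\lambda_3\lambda_4,\lambda_2\lambda_3\lambda_4\lambda_5\end{matrix};q,\lambda_1\lambda_5\right]=\frac{(\lambda_1\lambda_4,\lambda_2\lambda_4,\lambda_2\lambda_5;q)_\infty}{(\lambda_1\lambda_2\lambda_3\lambda_4,\lambda_2\lambda_3\lambda_4\lambda_5;q)_\infty}\sum_{n=0}^\infty\frac{\Phi_n(\lambda_1\lambda_2\lambda_3;\lambda_1,\lambda_2)\,\Phi_n(\lambda_3\lambda_4\lambda_5;\lambda_4,\lambda_5)}{(q;q)_n}.$$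
   Context: $(a;q)_\infty=\prod_{k\ge0}(1-aq^k)$, $(a;q)_n=\prod_{k=0}^{n-1}(1-aq^k)$, and $(a_1,\dots,a_r;q)_n=\prod_i(a_i;q)_n$ for $n\in\mathbb{Z}_{\ge0}\cup\{\infty\}$. ${}_3\phi_2\left[\begin{matrix}a,b,c\\d,e\end{matrix};q,z\right]=\sum_{n\ge0}\frac{(a,b,c;q)_n}{(q,d,e;q)_n}z^n$. Multivariate Al-Salam-Carlitz polynomials: for finite tuples $A=(a_1,\dots,a_r)$, $B=(b_1,\dots,b_s)$ of complex numbers, $\Phi_n(A;B)$ is defined by the formal power series identity in $z$: $\sum_{n\ge0}\Phi_n(A;B)\frac{z^n}{(q;q)_n}=\frac{\prod_{i=1}^r(a_iz;q)_\infty}{\prod_{i=1}^s(b_iz;q)_\infty}$ (tuples of different lengths may be padded with zeros). *)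

theory Defs
  imports "HOL-Analysis.Analysis" "HOL-Computational_Algebra.Formal_Power_Series"
begin

definition qpoch :: "complex \<Rightarrow> complex \<Rightarrow> nat \<Rightarrow> complex" where
  "qpoch a q n = (\<Prod>k<n. 1 - a * q ^ k)"

definition qpoch_inf :: "complex \<Rightarrow> complex \<Rightarrow> complex" where
  "qpoch_inf a q = (\<Prod>k. 1 - a * q ^ k)"

definition qpochs :: "complex list \<Rightarrow> complex \<Rightarrow> nat \<Rightarrow> complex" where
  "qpochs as q n = (\<Prod>a\<leftarrow>as. qpoch a q n)"

definition qpochs_inf :: "complex list \<Rightarrow> complex \<Rightarrow> complex" where
  "qpochs_inf as q = (\<Prod>a\<leftarrow>as. qpoch_inf a q)"

definition phi32_term ::
  "complex \<Rightarrow> complex \<Rightarrow> complex \<Rightarrow> complex \<Rightarrow> complex \<Rightarrow> complex \<Rightarrow> complex \<Rightarrow> nat \<Rightarrow> complex" where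
  "phi32_term a b c d e q z n = qpochs [a, b, c] q n / qpochs [q, d, e] q n * z ^ n"

definition phi32 ::
  "complex \<Rightarrow> complex \<Rightarrow> complex \<Rightarrow> complex \<Rightarrow> complex \<Rightarrow> complex \<Rightarrow> complex \<Rightarrow> complex" where
  "phi32 a b c d e q z = (\<Sum>n. phi32_term a b c d e q z n)"

(* (az;q)_infinity as a formal power series in z.  The partial products do not converge in the
   X-adic topology that the library puts on fps, only coefficientwise in the usual topology of
   the complex numbers, so the limit is taken in each coefficient (see qpoch_fps_tendsto). *)
definition qpoch_fps :: "complex \<Rightarrow> complex \<Rightarrow> complex fps" where
  "qpoch_fps a q =
     Abs_fps (\<lambda>n. lim (\<lambda>N. fps_nth (\<Prod>k<N. 1 - fps_const (a * q ^ k) * fps_X) n))"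

definition al_salam_carlitz_gf :: "complex \<Rightarrow> complex list \<Rightarrow> complex list \<Rightarrow> complex fps" where
  "al_salam_carlitz_gf q A B = (\<Prod>a\<leftarrow>A. qpoch_fps a q) / (\<Prod>b\<leftarrow>B. qpoch_fps b q)"

(* The generating function identity that characterises these numbers, solved for the n-th
   coefficient; the identity itself is al_salam_carlitz_generating below. *)
definition al_salam_carlitz ::
  "complex \<Rightarrow> complex list \<Rightarrow> complex list \<Rightarrow> nat \<Rightarrow> complex" where
  "al_salam_carlitz q A B n = qpoch q q n * fps_nth (al_salam_carlitz_gf q A B) n"

lemma qpoch_q_nonzero:
  assumes "norm q < 1"
  shows "qpoch q q n \<noteq> 0"
proof -
  have "1 - q * q ^ k \<noteq> 0" for k
  proof
    assume "1 - q * q ^ k = 0"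
    then have "q ^ Suc k = 1" by simp
    then have "norm q ^ Suc k = 1" by (metis norm_one norm_power)
    moreover have "norm q ^ Suc k \<le> norm q ^ 1"
      using assms by (intro power_decreasing) auto
    ultimately show False using assms by simp
  qed
  then show ?thesis by (simp add: qpoch_def)
qed

lemma al_salam_carlitz_generating:
  assumes "norm q < 1"
  shows "Abs_fps (\<lambda>n. al_salam_carlitz q A B n / qpoch q q n) =
    (\<Prod>a\<leftarrow>A. qpoch_fps a q) / (\<Prod>b\<leftarrow>B. qpoch_fps b q)"
  using qpoch_q_nonzero[OF assms]
  by (intro fps_ext) (simp add: al_salam_carlitz_def al_salam_carlitz_gf_def)

lemma qpoch_inf_convergent:
  fixes a q :: complex
  assumes "norm q < 1"
  shows "convergent_prod (\<lambda>k. 1 - a * q ^ k)"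
proof -
  have "summable (\<lambda>k. norm a * norm q ^ k)"
    using assms by (intro summable_mult summable_geometric) auto
  moreover have "norm (1 - a * q ^ k - 1) = norm a * norm q ^ k" for k
    by (simp add: norm_mult norm_power)
  ultimately have "abs_convergent_prod (\<lambda>k. 1 - a * q ^ k)"
    by (simp only: abs_convergent_prod_conv_summable)
  then show ?thesis by (rule abs_convergent_prod_imp_convergent_prod)
qed

lemma qpoch_fps_tendsto:
  assumes "norm q < 1"
  shows "(\<lambda>N. fps_nth (\<Prod>k<N. 1 - fps_const (a * q ^ k) * fps_X) n)
    \<longlonglongrightarrow> fps_nth (qpoch_fps a q) n"
proof -
  define P where "P n N = fps_nth (\<Prod>k<N. 1 - fps_const (a * q ^ k) * fps_X) n" for n N
  have step: "P (Suc n) (Suc N) - P (Suc n) N = - (a * q ^ N * P n N)" for n N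
  proof -
    have "(\<Prod>k<Suc N. 1 - fps_const (a * q ^ k) * fps_X) =
      (\<Prod>k<N. 1 - fps_const (a * q ^ k) * fps_X) -
      fps_const (a * q ^ N) * (fps_X * (\<Prod>k<N. 1 - fps_const (a * q ^ k) * fps_X))"
      by (simp add: algebra_simps)
    then show ?thesis
      unfolding P_def by (simp only: fps_sub_nth fps_mult_left_const_nth fps_X_mult_nth) simp
  qed
  have "convergent (P n)"
  proof (induction n)
    case 0
    have "P 0 N = 1" for N
      unfolding P_def by (induction N) auto
    then have "P 0 = (\<lambda>N. 1)" by (rule ext)
    then show ?case by (simp add: convergent_const)
  next
    case (Suc n)
    obtain K where K: "\<And>N. norm (P n N) \<le> K"
      using convergent_imp_Bseq[OF Suc.IH] by (meson BseqE)
    have "summable (\<lambda>N. norm a * K * norm q ^ N)"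
      using assms by (intro summable_mult summable_geometric) auto
    moreover have "norm (P (Suc n) (Suc N) - P (Suc n) N) \<le> norm a * K * norm q ^ N" for N
    proof -
      have "norm a * norm q ^ N * norm (P n N) \<le> norm a * norm q ^ N * K"
        by (intro mult_left_mono K) auto
      then show ?thesis
        unfolding step by (simp add: norm_mult norm_power mult_ac)
    qed
    ultimately have "summable (\<lambda>N. P (Suc n) (Suc N) - P (Suc n) N)"
      by (rule summable_comparison_test'[where N = 0])
    then have "convergent (\<lambda>m. P (Suc n) m - P (Suc n) 0)"
      by (simp only: summable_iff_convergent sum_lessThan_telescope)
    then show ?case by (simp only: convergent_diff_const_right_iff)
  qed
  then have "P n \<longlonglongrightarrow> lim (P n)"
    by (simp only: convergent_LIMSEQ_iff)
  moreover have "P n = (\<lambda>N. fps_nth (\<Prod>k<N. 1 - fps_const (a * q ^ k) * fps_X) n)"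
    by (rule ext) (rule P_def)
  ultimately show ?thesis
    by (simp only: qpoch_fps_def fps_nth_Abs_fps)
qed

lemma qpoch_fps_nth_0: "fps_nth (qpoch_fps a q) 0 = 1"
proof -
  have "fps_nth (\<Prod>k<N. 1 - fps_const (a * q ^ k) * fps_X) 0 = 1" for N
    by (induction N) auto
  then show ?thesis by (simp add: qpoch_fps_def)
qed

end

theory Submission
  imports Defs
begin

text \<open>
  With \<open>a = \<lambda>\<^sub>2\<lambda>\<^sub>3\<close> and \<open>b = \<lambda>\<^sub>3\<lambda>\<^sub>4\<close>, the q-binomial theorem writes \<open>\<Phi>\<^sub>n(a\<lambda>\<^sub>1; \<lambda>\<^sub>1, \<lambda>\<^sub>2)\<close> and
  \<open>\<Phi>\<^sub>n(b\<lambda>\<^sub>5; \<lambda>\<^sub>4, \<lambda>\<^sub>5)\<close> as sums over \<open>k \<le> n\<close> and \<open>j \<le> n\<close>. The product of the q-binomial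
  coefficients that occur is linearised by the q-Vandermonde identity
  \<open>[n, j] = \<Sum>r. [k, r] [n - k, j - r] q\<^bsup>r (n - k - j + r)\<^esup>\<close>, which turns the right-hand side into an
  absolutely convergent quadruple series in \<open>r\<close>, \<open>m = n - k - j + r\<close>, \<open>k - r\<close>, \<open>j - r\<close>. Of the two
  forms of q-Vandermonde, this one couples only \<open>r\<close> and \<open>m\<close>: for fixed \<open>r\<close> the other three sums
  separate, each is evaluated by the q-binomial theorem, and the sum over \<open>r\<close> is the \<open>3\<phi>2\<close> series.
\<close>

section \<open>Finite and infinite q-Pochhammer symbols\<close>

lemma qpoch_0 [simp]: "qpoch a q 0 = 1"
  by (simp add: qpoch_def)

lemma qpoch_Suc: "qpoch a q (Suc n) = qpoch a q n * (1 - a * q ^ n)"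
  by (simp add: qpoch_def)

lemma qpoch_zero_left [simp]: "qpoch 0 q n = 1"
  by (simp add: qpoch_def)

lemma qpoch_add: "qpoch a q (m + n) = qpoch a q m * qpoch (a * q ^ m) q n"
  by (induction n) (simp_all add: qpoch_Suc power_add mult_ac)

context
  fixes q :: complex
  assumes q: "norm q < 1"
begin

lemma qpoch_inf_split: "qpoch_inf a q = qpoch a q n * qpoch_inf (a * q ^ n) q"
  using has_prod_unique[OF has_prod_ignore_initial_segment'[OF qpoch_inf_convergent[OF q]], of a n]
  by (simp add: qpoch_inf_def qpoch_def power_add mult_ac)

lemma qpoch_tendsto: "qpoch a q \<longlonglongrightarrow> qpoch_inf a q"
proof -
  have "(\<lambda>n. qpoch a q (Suc n)) \<longlonglongrightarrow> qpoch_inf a q"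
    using convergent_prod_LIMSEQ[OF qpoch_inf_convergent[OF q]]
    by (simp add: qpoch_inf_def qpoch_def lessThan_Suc_atMost del: prod.lessThan_Suc)
  then show ?thesis by (rule LIMSEQ_imp_Suc)
qed

lemma qpoch_inf_nonzero:
  assumes "\<And>n. a * q ^ n \<noteq> 1"
  shows "qpoch_inf a q \<noteq> 0"
  unfolding qpoch_inf_def using assms
  by (intro prodinf_nonzero qpoch_inf_convergent[OF q]) (metis eq_iff_diff_eq_0)

lemma mult_power_neq_1:
  assumes "norm a < 1"
  shows "a * q ^ n \<noteq> 1"
proof
  assume "a * q ^ n = 1"
  then have "norm a * norm q ^ n = 1"
    by (metis norm_mult norm_one norm_power)
  moreover have "norm a * norm q ^ n \<le> norm a * 1"
    using q by (intro mult_left_mono power_le_one) auto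
  ultimately show False using assms by simp
qed

lemma qpoch_bounded: "\<exists>C>0. \<forall>n. norm (qpoch a q n) \<le> C"
  using convergent_imp_Bseq[OF convergentI[OF qpoch_tendsto]] by (auto simp: Bseq_def)

text \<open>The limit \<open>qpoch_inf q q\<close> is nonzero, so the reciprocals converge as well.
  Bounds uniform in \<open>n\<close> feed the geometric majorants below.\<close>

lemma inverse_qpoch_bounded: "\<exists>C>0. \<forall>n. norm (inverse (qpoch q q n)) \<le> C"
proof -
  have "(\<lambda>n. inverse (qpoch q q n)) \<longlonglongrightarrow> inverse (qpoch_inf q q)"
    by (intro tendsto_inverse qpoch_tendsto qpoch_inf_nonzero mult_power_neq_1 q)
  from convergent_imp_Bseq[OF convergentI[OF this]] show ?thesis
    by (simp only: Bseq_def)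
qed

section \<open>The q-binomial theorem for convergent series\<close>

definition qbinom_coeff :: "complex \<Rightarrow> nat \<Rightarrow> complex" where
  "qbinom_coeff a n = qpoch a q n / qpoch q q n"

lemma qbinom_coeff_0 [simp]: "qbinom_coeff a 0 = 1"
  by (simp add: qbinom_coeff_def)

text \<open>Both the analytic and the formal functional equation come from this recurrence.\<close>

lemma qbinom_coeff_Suc:
  "qbinom_coeff a (Suc n) * (1 - q ^ Suc n) = qbinom_coeff a n * (1 - a * q ^ n)"
  using qpoch_q_nonzero[OF q, of n] qpoch_q_nonzero[OF q, of "Suc n"]
  by (simp add: qbinom_coeff_def qpoch_Suc divide_simps)

lemma qbinom_coeff_bounded: "\<exists>C>0. \<forall>n. norm (qbinom_coeff a n) \<le> C"
proof -
  obtain C where "C > 0" and C: "\<And>n. norm (qpoch a q n) \<le> C"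
    using qpoch_bounded by blast
  obtain D where "D > 0" and D: "\<And>n. norm (inverse (qpoch q q n)) \<le> D"
    using inverse_qpoch_bounded by blast
  have "norm (qbinom_coeff a n) \<le> C * D" for n
    unfolding qbinom_coeff_def divide_inverse norm_mult
    using \<open>C > 0\<close> by (intro mult_mono C D) auto
  then show ?thesis using \<open>C > 0\<close> \<open>D > 0\<close> by (intro exI[of _ "C * D"]) auto
qed

lemma qbinom_summable_norm:
  assumes "norm z < 1"
  shows "summable (\<lambda>n. norm (qbinom_coeff a n * z ^ n))"
proof -
  obtain C where C: "\<And>n. norm (qbinom_coeff a n) \<le> C"
    using qbinom_coeff_bounded by blast
  have "summable (\<lambda>n. C * norm z ^ n)"
    using assms by (intro summable_mult summable_geometric) auto
  then show ?thesis
    by (rule summable_comparison_test'[where N = 0])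
       (auto simp: norm_mult norm_power intro!: mult_right_mono C)
qed

lemma qbinom_summable:
  assumes "norm z < 1"
  shows "summable (\<lambda>n. qbinom_coeff a n * z ^ n)"
  using qbinom_summable_norm[OF assms] by (rule summable_norm_cancel)

lemma norm_mult_power_q_le: "norm (z * q ^ n) \<le> norm z"
  using q by (simp add: norm_mult norm_power mult_left_le power_le_one)

text \<open>Passing from z to zq multiplies the n-th coefficient by q^n. The recurrence turns the
  factor 1 - q^n in F(z) - F(zq) into an index shift, that is, into multiplication by z.\<close>

lemma qbinom_functional_equation:
  fixes a z :: complex
  assumes z: "norm z < 1"
  defines "F \<equiv> \<lambda>z. \<Sum>n. qbinom_coeff a n * z ^ n"
  shows "(1 - z) * F z = (1 - a * z) * F (z * q)"
proof -
  have zq: "norm (z * q) < 1"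
    using norm_mult_power_q_le[of z 1] z by simp
  note s = qbinom_summable[OF z, of a] and sq = qbinom_summable[OF zq, of a]
  have "F z - F (z * q) = (\<Sum>n. qbinom_coeff a n * (1 - q ^ n) * z ^ n)"
    unfolding F_def suminf_diff[OF s sq]
    by (intro suminf_cong) (simp add: algebra_simps power_mult_distrib)
  \<comment> \<open>The term at n = 0 vanishes because of the factor 1 - q^0.\<close>
  also have "\<dots> = (\<Sum>n. qbinom_coeff a (Suc n) * (1 - q ^ Suc n) * z ^ Suc n)"
  proof -
    have "summable (\<lambda>n. qbinom_coeff a n * (1 - q ^ n) * z ^ n)"
      using summable_diff[OF s sq] by (simp add: algebra_simps power_mult_distrib)
    from suminf_split_head[OF this] show ?thesis by simp
  qed
  also have "\<dots> = (\<Sum>n. z * (qbinom_coeff a n * z ^ n) - a * z * (qbinom_coeff a n * (z * q) ^ n))"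
    unfolding qbinom_coeff_Suc
    by (intro suminf_cong) (simp add: algebra_simps power_mult_distrib)
  also have "\<dots> = z * F z - a * z * F (z * q)"
    unfolding F_def
    by (simp only: suminf_diff[OF summable_mult[OF s] summable_mult[OF sq], symmetric]
        suminf_mult[OF s, symmetric] suminf_mult[OF sq, symmetric])
  finally show ?thesis by (simp add: algebra_simps)
qed

text \<open>Iterating the functional equation moves the argument to z q^N, which tends to 0, where F
  is continuous with value 1.\<close>

lemma qbinom_suminf:
  assumes z: "norm z < 1"
  shows "(\<Sum>n. qbinom_coeff a n * z ^ n) = qpoch_inf (a * z) q / qpoch_inf z q"
proof -
  define F where "F z = (\<Sum>n. qbinom_coeff a n * z ^ n)" for z
  have iter: "qpoch z q N * F z = qpoch (a * z) q N * F (z * q ^ N)" for N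
  proof (induction N)
    case (Suc N)
    have "norm (z * q ^ N) < 1"
      using norm_mult_power_q_le z by (rule le_less_trans)
    then have "(1 - z * q ^ N) * F (z * q ^ N) = (1 - a * (z * q ^ N)) * F (z * q ^ N * q)"
      unfolding F_def by (rule qbinom_functional_equation)
    then have "qpoch (a * z) q (Suc N) * F (z * q ^ Suc N)
        = (qpoch (a * z) q N * F (z * q ^ N)) * (1 - z * q ^ N)"
      by (simp add: qpoch_Suc mult_ac)
    then show ?case
      unfolding Suc.IH[symmetric] by (simp add: qpoch_Suc mult_ac)
  qed simp
  \<comment> \<open>Any nonzero point of the open unit disc serves as \<open>K\<close>: the power
    series converges there.\<close>
  have "isCont F 0"
    unfolding F_def by (rule isCont_powser[where K = "1/2"]) (auto intro: qbinom_summable)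
  moreover have "(\<lambda>N. z * q ^ N) \<longlonglongrightarrow> 0"
    using tendsto_mult_right_zero[OF LIMSEQ_power_zero[OF q]] .
  ultimately have "(\<lambda>N. F (z * q ^ N)) \<longlonglongrightarrow> F 0"
    by (rule isCont_tendsto_compose)
  moreover have "F 0 = 1"
    by (simp add: F_def)
  ultimately have "(\<lambda>N. qpoch (a * z) q N * F (z * q ^ N)) \<longlonglongrightarrow> qpoch_inf (a * z) q * 1"
    by (intro tendsto_mult qpoch_tendsto) simp
  then have "(\<lambda>N. qpoch z q N * F z) \<longlonglongrightarrow> qpoch_inf (a * z) q"
    by (simp add: iter)
  moreover have "(\<lambda>N. qpoch z q N * F z) \<longlonglongrightarrow> qpoch_inf z q * F z"
    by (intro tendsto_mult qpoch_tendsto tendsto_const)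
  ultimately have "qpoch_inf z q * F z = qpoch_inf (a * z) q"
    using LIMSEQ_unique by blast
  moreover have "qpoch_inf z q \<noteq> 0"
    by (intro qpoch_inf_nonzero mult_power_neq_1 z)
  ultimately show ?thesis
    by (simp add: F_def divide_simps mult_ac)
qed

lemma qbinom_has_sum:
  assumes z: "norm z < 1"
  shows "((\<lambda>n. qbinom_coeff a n * z ^ n) has_sum (qpoch_inf (a * z) q / qpoch_inf z q)) UNIV"
  using norm_summable_imp_has_sum[OF qbinom_summable_norm[OF z] summable_sums[OF qbinom_summable[OF z]]]
  by (simp only: qbinom_suminf[OF z])

section \<open>Formal q-binomial theorem and the generating function\<close>

text \<open>The partial products satisfy P_(N+1)(X) = (1 - aX) P_N(qX), and this survives the
  coefficientwise limit.\<close>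

lemma qpoch_fps_functional_equation:
  "qpoch_fps a q = (1 - fps_const a * fps_X) * (qpoch_fps a q oo (fps_const q * fps_X))"
proof (rule fps_ext)
  fix n
  define P where "P N = (\<Prod>k<N. 1 - fps_const (a * q ^ k) * fps_X)" for N
  have P: "P (Suc N) = (1 - fps_const a * fps_X) * (P N oo (fps_const q * fps_X))" for N
  proof (induction N)
    case (Suc N)
    have "(1 - fps_const (a * q ^ N) * fps_X) oo (fps_const q * fps_X)
        = 1 - fps_const (a * q ^ Suc N) * fps_X"
      by (simp add: fps_compose_sub_distrib fps_compose_mult_distrib mult_ac
          flip: fps_const_mult)
    moreover have "P (Suc (Suc N)) = P (Suc N) * (1 - fps_const (a * q ^ Suc N) * fps_X)"
      by (simp add: P_def)
    moreover have "P (Suc N) oo (fps_const q * fps_X) = (P N oo (fps_const q * fps_X))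
        * ((1 - fps_const (a * q ^ N) * fps_X) oo (fps_const q * fps_X))"
      by (simp add: P_def fps_compose_mult_distrib)
    ultimately show ?case
      by (simp only: Suc.IH mult.assoc)
  qed (simp add: P_def)
  have lim: "(\<lambda>N. fps_nth (P N) n) \<longlonglongrightarrow> fps_nth (qpoch_fps a q) n" for n
    unfolding P_def by (rule qpoch_fps_tendsto[OF q])
  \<comment> \<open>Coefficient n of the right-hand side involves only coefficients n and n - 1 of
    \<open>f\<close>, so coefficientwise limits pass through it.\<close>
  have nth: "fps_nth ((1 - fps_const a * fps_X) * (f oo (fps_const q * fps_X))) n =
    q ^ n * fps_nth f n - (if n = 0 then 0 else a * (q ^ (n - 1) * fps_nth f (n - 1)))"
    for f :: "complex fps"
    by (simp add: fps_compose_linear left_diff_distrib mult.assoc fps_X_mult_nth)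
  have "(\<lambda>N. fps_nth (P (Suc N)) n) \<longlonglongrightarrow>
    fps_nth ((1 - fps_const a * fps_X) * (qpoch_fps a q oo (fps_const q * fps_X))) n"
    unfolding P nth by (cases "n = 0") (auto intro!: tendsto_intros lim)
  with lim[of n, THEN LIMSEQ_Suc]
  show "fps_nth (qpoch_fps a q) n =
    fps_nth ((1 - fps_const a * fps_X) * (qpoch_fps a q oo (fps_const q * fps_X))) n"
    by (rule LIMSEQ_unique)
qed

text \<open>Comparing coefficients of X^(n+1) gives (1 - q^(n+1)) f_(n+1) = -a q^n f_n, and 1 -
  q^(n+1) is never zero, so f_0 determines f.\<close>

lemma q_functional_equation_unique:
  assumes f: "f = (1 - fps_const a * fps_X) * (f oo (fps_const q * fps_X))" and f0: "fps_nth f 0 = 1"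
  shows "f = qpoch_fps a q"
proof (rule fps_ext)
  have step: "(1 - q ^ Suc n) * fps_nth f (Suc n) = - (a * q ^ n * fps_nth f n)"
    if "f = (1 - fps_const a * fps_X) * (f oo (fps_const q * fps_X))" for f :: "complex fps" and n
    using arg_cong[OF that, of "\<lambda>f. fps_nth f (Suc n)"]
    by (simp add: fps_compose_linear left_diff_distrib mult.assoc) (simp add: algebra_simps)
  fix n
  show "fps_nth f n = fps_nth (qpoch_fps a q) n"
  proof (induction n)
    case (Suc n)
    have "(1 - q ^ Suc n) * fps_nth f (Suc n) = (1 - q ^ Suc n) * fps_nth (qpoch_fps a q) (Suc n)"
      by (simp only: step[OF f] step[OF qpoch_fps_functional_equation] Suc.IH)
    moreover have "1 - q ^ Suc n \<noteq> 0"
      using mult_power_neq_1[OF q, of n] by simp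
    ultimately show ?case by simp
  qed (simp add: f0 qpoch_fps_nth_0)
qed

text \<open>The first factor F satisfies (1 - cX) F(X) = (1 - acX) F(qX). Combined with the equation
  for \<open>qpoch_fps c q\<close>, this is the equation that characterises
  \<open>qpoch_fps (a * c) q\<close>.\<close>

lemma qbinom_fps:
  "Abs_fps (\<lambda>n. qbinom_coeff a n * c ^ n) * qpoch_fps c q = qpoch_fps (a * c) q"
proof (rule q_functional_equation_unique)
  let ?F = "Abs_fps (\<lambda>n. qbinom_coeff a n * c ^ n)" and ?s = "fps_const q * fps_X :: complex fps"
  have F: "(1 - fps_const c * fps_X) * ?F = (1 - fps_const (a * c) * fps_X) * (?F oo ?s)"
  proof (rule fps_ext)
    fix n
    show "fps_nth ((1 - fps_const c * fps_X) * ?F) n =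
      fps_nth ((1 - fps_const (a * c) * fps_X) * (?F oo ?s)) n"
    proof (cases n)
      case (Suc m)
      have "c * c ^ m * qbinom_coeff a (Suc m) - c * (c ^ m * qbinom_coeff a m) =
        q * q ^ m * (c * c ^ m * qbinom_coeff a (Suc m)) - a * c * (q ^ m * (c ^ m * qbinom_coeff a m))"
      proof -
        \<comment> \<open>Here u and v stand for consecutive coefficients, C for c^m and Q for
          q^m.\<close>
        have "c * C * u - c * (C * v) = q * Q * (c * C * u) - a * c * (Q * (C * v))"
          if "u * (1 - q * Q) = v * (1 - a * Q)" for C Q u v :: complex
          using that by algebra
        then show ?thesis
          using qbinom_coeff_Suc[of a m, unfolded power_Suc] .
      qed
      then show ?thesis
        by (simp add: Suc fps_compose_linear left_diff_distrib mult.assoc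
            del: fps_const_mult mult_cancel_left mult_cancel_right)
           (simp add: mult_ac del: mult_cancel_left mult_cancel_right)
    qed (simp add: fps_compose_linear left_diff_distrib mult.assoc)
  qed
  have "?F * qpoch_fps c q = (1 - fps_const c * fps_X) * ?F * (qpoch_fps c q oo ?s)"
    by (subst qpoch_fps_functional_equation) (simp only: mult_ac)
  also have "\<dots> = (1 - fps_const (a * c) * fps_X) * ((?F * qpoch_fps c q) oo ?s)"
    unfolding F by (subst fps_compose_mult_distrib) (simp_all only: mult.assoc, simp)
  finally show "?F * qpoch_fps c q
      = (1 - fps_const (a * c) * fps_X) * ((?F * qpoch_fps c q) oo ?s)" .
qed (simp add: qpoch_fps_nth_0)

lemma qpoch_fps_0: "qpoch_fps 0 q = 1"
  by (rule q_functional_equation_unique[symmetric]) auto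

text \<open>The formal q-binomial theorem expands the quotient of \<open>qpoch_fps (a * c) q\<close>
  by \<open>qpoch_fps c q\<close>; its case a = 0 expands the reciprocal of
  \<open>qpoch_fps b q\<close>.\<close>

lemma al_salam_carlitz_gf_eq:
  "qpoch_fps (a * c) q / (qpoch_fps c q * qpoch_fps b q) =
    Abs_fps (\<lambda>n. qbinom_coeff a n * c ^ n) * Abs_fps (\<lambda>n. qbinom_coeff 0 n * b ^ n)"
    (is "_ = ?F * ?G")
proof -
  have nz: "qpoch_fps x q \<noteq> 0" for x
    using qpoch_fps_nth_0[of x q] by force
  have "?F * ?G * (qpoch_fps c q * qpoch_fps b q)
      = (?F * qpoch_fps c q) * (?G * qpoch_fps b q)"
    by (simp only: mult_ac)
  also have "\<dots> = qpoch_fps (a * c) q"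
    by (simp only: qbinom_fps) (simp add: qpoch_fps_0)
  finally show ?thesis
    using nz by (metis (no_types, lifting) mult_eq_0_iff nonzero_mult_div_cancel_right)
qed

section \<open>Gaussian binomial coefficients and the q-Vandermonde identity\<close>

text \<open>For k > n the subtraction \<open>n - k\<close> is truncated, so the value 0 is imposed;
  it lets q-Vandermonde sum over all r \<le> j.\<close>

definition qbinomial :: "nat \<Rightarrow> nat \<Rightarrow> complex" where
  "qbinomial n k = (if k \<le> n then qpoch q q n / (qpoch q q k * qpoch q q (n - k)) else 0)"

lemma qbinomial_0_right [simp]: "qbinomial n 0 = 1"
  using qpoch_q_nonzero[OF q] by (simp add: qbinomial_def)

lemma qbinomial_self: "qbinomial n n = 1"
  using qpoch_q_nonzero[OF q] by (simp add: qbinomial_def)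

lemma qbinomial_eq_0: "n < k \<Longrightarrow> qbinomial n k = 0"
  by (simp add: qbinomial_def)

text \<open>For n = k + d + 1 this q-Pascal rule reduces to 1 - q^(n+1) = (1 - q^(k+1)) + q^(k+1) (1
  - q^(d+1)).\<close>

lemma qbinomial_Suc_Suc:
  "qbinomial (Suc n) (Suc k) = qbinomial n k + q ^ Suc k * qbinomial n (Suc k)"
proof -
  consider "n < k" | "n = k" | d where "n = Suc (k + d)"
    by (metis less_iff_Suc_add linorder_neqE_nat)
  then show ?thesis
  proof cases
    case 3
    have nz: "qpoch q q n \<noteq> 0" for n
      by (rule qpoch_q_nonzero[OF q])
    have f: "1 - q * q ^ n \<noteq> 0" for n
      using nz[of "Suc n"] by (simp add: qpoch_Suc)
    have e1: "qbinomial n k = qpoch q q n / (qpoch q q k * qpoch q q d * (1 - q * q ^ d))"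
      using 3 by (simp add: qbinomial_def Suc_diff_le qpoch_Suc mult.assoc)
    have e2: "qbinomial n (Suc k) = qpoch q q n / (qpoch q q k * (1 - q * q ^ k) * qpoch q q d)"
      using 3 by (simp add: qbinomial_def qpoch_Suc)
    have e3: "qbinomial (Suc n) (Suc k) = qpoch q q n * (1 - q * (q * q ^ k * q ^ d))
        / (qpoch q q k * (1 - q * q ^ k) * (qpoch q q d * (1 - q * q ^ d)))"
      using 3 by (simp add: qbinomial_def Suc_diff_le qpoch_Suc power_add mult.assoc)
    show ?thesis
      unfolding e1 e2 e3 power_Suc using nz[of k] nz[of d] f[of k] f[of d]
      by (simp add: divide_simps) algebra
  qed (auto simp: qbinomial_eq_0 qbinomial_self)
qed

text \<open>By the q-Pascal rule both sides satisfy the same recursion in n and j.\<close>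

lemma qbinomial_vandermonde:
  "qbinomial (m + n) j = (\<Sum>r\<le>j. qbinomial m r * qbinomial n (j - r) * q ^ (r * (n - (j - r))))"
proof (induction n arbitrary: j)
  case 0
  have "qbinomial m r * qbinomial 0 (j - r) * q ^ (r * (0 - (j - r))) =
    (if r = j then qbinomial m j else 0)" if "r \<le> j" for r
    using that by (auto simp: qbinomial_eq_0)
  then show ?case by simp
next
  case (Suc n)
  show ?case
  proof (cases j)
    case [simp]: (Suc i)
    let ?t = "\<lambda>n j r. qbinomial m r * qbinomial n (j - r) * q ^ (r * (n - (j - r)))"
    \<comment> \<open>For r \<le> i the recursion holds termwise. When \<open>d < n\<close> fails, a
      truncated exponent occurs only beside a vanishing coefficient.\<close>
    have step: "?t (Suc n) (Suc i) r = ?t n i r + q ^ Suc i * ?t n (Suc i) r" if "r \<le> i" for r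
    proof -
      obtain d where i: "i = r + d"
        using le_Suc_ex[OF \<open>r \<le> i\<close>] by blast
      show ?thesis
      proof (cases "d < n")
        case True
        then obtain e where "n = Suc (d + e)"
          by (auto dest: less_imp_Suc_add)
        then show ?thesis
          by (simp add: i Suc_diff_le qbinomial_Suc_Suc power_add) (simp add: algebra_simps)
      next
        case False
        then show ?thesis
          by (simp add: i Suc_diff_le qbinomial_Suc_Suc qbinomial_eq_0)
      qed
    qed
    have "qbinomial (m + Suc n) j = qbinomial (m + n) i + q ^ Suc i * qbinomial (m + n) (Suc i)"
      by (simp add: qbinomial_Suc_Suc)
    \<comment> \<open>The term r = i + 1 is split off: it has no counterpart in the sum up to i,
      where \<open>i - r\<close> would be truncated.\<close>
    also have "\<dots> = (\<Sum>r\<le>i. ?t n i r + q ^ Suc i * ?t n (Suc i) r) + q ^ Suc i * ?t n (Suc i) (Suc i)"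
      by (simp add: Suc.IH sum.distrib sum_distrib_left distrib_left)
    also have "q ^ Suc i * ?t n (Suc i) (Suc i) = ?t (Suc n) (Suc i) (Suc i)"
      by (simp add: power_add)
    also have "(\<Sum>r\<le>i. ?t n i r + q ^ Suc i * ?t n (Suc i) r) = (\<Sum>r\<le>i. ?t (Suc n) (Suc i) r)"
      by (intro sum.cong refl step[symmetric]) simp
    finally show ?thesis by simp
  qed simp
qed


text \<open>Apply q-Vandermonde to [n, j] with n = k + (n - k): the numerators of the two new
  coefficients cancel \<open>qpoch q q k\<close> and \<open>qpoch q q (n - k)\<close>.\<close>

lemma qbinomial_product:
  assumes "k \<le> n" "j \<le> n"
  shows "qpoch q q n / (qpoch q q k * qpoch q q (n - k) * (qpoch q q j * qpoch q q (n - j))) =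
    (\<Sum>r | r \<le> k \<and> r \<le> j \<and> k + j \<le> n + r. q ^ (r * (n + r - k - j)) /
      (qpoch q q r * qpoch q q (k - r) * qpoch q q (j - r) * qpoch q q (n + r - k - j)))"
proof -
  note nz = qpoch_q_nonzero[OF q]
  let ?R = "{r. r \<le> k \<and> r \<le> j \<and> k + j \<le> n + r}"
  let ?t = "\<lambda>r. qbinomial k r * qbinomial (n - k) (j - r) * q ^ (r * (n - k - (j - r)))"
  let ?c = "qpoch q q k * qpoch q q (n - k)"
  have "qpoch q q n / (?c * (qpoch q q j * qpoch q q (n - j))) = qbinomial (k + (n - k)) j / ?c"
    using assms nz by (simp add: qbinomial_def)
  also have "\<dots> = (\<Sum>r\<le>j. ?t r) / ?c"
    by (simp only: qbinomial_vandermonde)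
  \<comment> \<open>For r \<le> j the last condition in \<open>?R\<close> says j - r \<le> n - k, so
    outside \<open>?R\<close> one of the two coefficients is zero.\<close>
  also have "(\<Sum>r\<le>j. ?t r) = (\<Sum>r\<in>?R. ?t r)"
    using assms by (intro sum.mono_neutral_right) (auto simp: qbinomial_def)
  also have "(\<Sum>r\<in>?R. ?t r) / ?c = (\<Sum>r\<in>?R. q ^ (r * (n + r - k - j)) /
      (qpoch q q r * qpoch q q (k - r) * qpoch q q (j - r) * qpoch q q (n + r - k - j)))"
    unfolding sum_divide_distrib
  proof (intro sum.cong refl)
    fix r assume r: "r \<in> ?R"
    then have "n - k - (j - r) = n + r - k - j" "j - r \<le> n - k"
      using assms by auto
    then show "?t r / ?c = q ^ (r * (n + r - k - j)) /
        (qpoch q q r * qpoch q q (k - r) * qpoch q q (j - r) * qpoch q q (n + r - k - j))"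
      using r nz by (simp add: qbinomial_def)
  qed
  finally show ?thesis .
qed

lemma al_salam_carlitz_eq:
  "fps_nth (qpoch_fps (a * c) q / (qpoch_fps c q * qpoch_fps b q)) n =
    (\<Sum>k\<le>n. qpoch a q k * c ^ k * b ^ (n - k) / (qpoch q q k * qpoch q q (n - k)))"
  unfolding al_salam_carlitz_gf_eq
  by (simp add: fps_mult_nth qbinom_coeff_def atLeast0AtMost)

end

section \<open>Absolute convergence of the quadruple series\<close>

lemma summable_on_Times_mult:
  fixes f :: "'a \<Rightarrow> real" and g :: "'b \<Rightarrow> real"
  assumes f: "f summable_on A" and g: "g summable_on B"
    and "\<And>x. x \<in> A \<Longrightarrow> 0 \<le> f x" "\<And>y. y \<in> B \<Longrightarrow> 0 \<le> g y"
  shows "(\<lambda>(x, y). f x * g y) summable_on A \<times> B"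
proof (rule summable_on_SigmaI)
  show "((\<lambda>y. case (x, y) of (x, y) \<Rightarrow> f x * g y) has_sum (f x * infsum g B)) B" for x
    using has_sum_cmult_right[OF has_sum_infsum[OF g]] by simp
  show "(\<lambda>x. f x * infsum g B) summable_on A"
    by (intro summable_on_cmult_left f)
qed (use assms in auto)

lemma geometric_summable_on:
  fixes x :: complex
  assumes "norm x < 1"
  shows "(\<lambda>n. norm x ^ n) summable_on UNIV"
  using assms by (intro norm_summable_imp_summable_on) (simp add: norm_power summable_geometric)

locale mehler_sum =
  fixes q a b l1 l2 l4 l5 :: complex
  assumes q: "norm q < 1"
    and norms: "norm (l1 * l4) < 1" "norm (l1 * l5) < 1" "norm (l2 * l4) < 1" "norm (l2 * l5) < 1"
begin

text \<open>The indices \<open>k\<close> and \<open>j\<close> are already shifted: the original ones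
  are k + r, j + r and n = r + m + k + j, so \<open>l2\<close> has exponent n - (k + r) = m + j. The
  nesting of the pairs lets j, k and m be summed out in this order, leaving r.\<close>

definition quad_term :: "((nat \<times> nat) \<times> nat) \<times> nat \<Rightarrow> complex" where
  "quad_term = (\<lambda>(((r, m), k), j).
     qpoch a q (k + r) * qpoch b q (j + r) * l1 ^ (k + r) * l5 ^ (j + r) * l2 ^ (m + j) * l4 ^ (m + k)
     * q ^ (r * m) / (qpoch q q r * qpoch q q k * qpoch q q j * qpoch q q m))"

text \<open>Regrouping the powers exhibits four geometric ratios, exactly those bounded in
  \<open>norms\<close>.\<close>

lemma quad_term_eq:
  "quad_term (((r, m), k), j) = qpoch a q (k + r) * qpoch b q (j + r) * q ^ (r * m) *
     inverse (qpoch q q r) * inverse (qpoch q q k) * inverse (qpoch q q j) * inverse (qpoch q q m) *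
     ((l1 * l5) ^ r * (l2 * l4) ^ m * (l1 * l4) ^ k * (l2 * l5) ^ j)"
  by (simp add: quad_term_def divide_inverse power_add power_mult_distrib mult_ac)

lemma quad_term_summable: "quad_term summable_on UNIV"
proof -
  obtain C where "C > 0" and C: "\<And>n. norm (qpoch a q n) \<le> C"
    using qpoch_bounded[OF q] by blast
  obtain D where "D > 0" and D: "\<And>n. norm (qpoch b q n) \<le> D"
    using qpoch_bounded[OF q] by blast
  obtain E where "E > 0" and E: "\<And>n. norm (inverse (qpoch q q n)) \<le> E"
    using inverse_qpoch_bounded[OF q] by blast
  define g where "g = (\<lambda>(((r, m), k), j). norm (l1 * l5) ^ r * norm (l2 * l4) ^ m *
    norm (l1 * l4) ^ k * norm (l2 * l5) ^ j)"
  have "g summable_on ((UNIV \<times> UNIV) \<times> UNIV) \<times> UNIV"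
    using summable_on_Times_mult[OF summable_on_Times_mult[OF summable_on_Times_mult[OF
        geometric_summable_on[OF norms(2)] geometric_summable_on[OF norms(3)]]
        geometric_summable_on[OF norms(1)]] geometric_summable_on[OF norms(4)]]
    by (simp add: g_def case_prod_unfold)
  \<comment> \<open>The constants match the factors of \<open>quad_term_eq\<close> one by one; the 1
    bounds the power of q.\<close>
  then have "(\<lambda>x. C * D * 1 * E * E * E * E * g x) summable_on UNIV"
    by (intro summable_on_cmult_right) simp
  moreover have "norm (quad_term x) \<le> C * D * 1 * E * E * E * E * g x" for x
  proof -
    obtain r m k j where x: "x = (((r, m), k), j)"
      by (metis surj_pair)
    have "norm q ^ (r * m) \<le> 1"
      using q by (intro power_le_one) auto
    then show ?thesis
      unfolding x quad_term_eq g_def norm_mult norm_power prod.case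
      using \<open>C > 0\<close> \<open>D > 0\<close> \<open>E > 0\<close> by (intro mult_mono C D E) auto
  qed
  ultimately have "(\<lambda>x. norm (quad_term x)) summable_on UNIV"
    by (rule Infinite_Sum.abs_summable_on_comparison_test')
  then show ?thesis
    by (rule abs_summable_summable)
qed

section \<open>Summing over j, k and m for fixed r\<close>

lemma quad_sum_right:
  "((\<lambda>r. qpoch a q r * qpoch b q r / qpoch q q r * (l1 * l5) ^ r *
      (qpoch_inf (a * l1 * l4 * q ^ r) q * qpoch_inf (b * l2 * l5 * q ^ r) q /
       (qpoch_inf (l1 * l4) q * qpoch_inf (l2 * l5) q * qpoch_inf (l2 * l4 * q ^ r) q)))
    has_sum infsum quad_term UNIV) UNIV"
proof -
  define A where "A r = qpoch_inf (a * l1 * l4 * q ^ r) q / qpoch_inf (l1 * l4) q" for r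
  define B where "B r = qpoch_inf (b * l2 * l5 * q ^ r) q / qpoch_inf (l2 * l5) q" for r
  define G where "G r = 1 / qpoch_inf (l2 * l4 * q ^ r) q" for r
  define c where "c r = qpoch a q r * qpoch b q r / qpoch q q r * (l1 * l5) ^ r" for r
  \<comment> \<open>Splitting \<open>qpoch a q (k + r)\<close> at r leaves the parameter a q^r,
    likewise for b, and q^(rm) is absorbed into the ratio of the m-series.\<close>
  have split: "quad_term (((r, m), k), j) = c r * (qbinom_coeff q 0 m * (l2 * l4 * q ^ r) ^ m) *
      (qbinom_coeff q (a * q ^ r) k * (l1 * l4) ^ k) * (qbinom_coeff q (b * q ^ r) j * (l2 * l5) ^ j)"
    for r m k j
    by (simp add: quad_term_eq c_def qbinom_coeff_def[OF q] divide_inverse qpoch_add add.commute[of _ r]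
        power_mult_distrib mult_ac flip: power_mult)
  have sA: "((\<lambda>k. qbinom_coeff q (a * q ^ r) k * (l1 * l4) ^ k) has_sum A r) UNIV" for r
    using qbinom_has_sum[OF q norms(1), of "a * q ^ r"] by (simp add: A_def mult_ac)
  have sB: "((\<lambda>j. qbinom_coeff q (b * q ^ r) j * (l2 * l5) ^ j) has_sum B r) UNIV" for r
    using qbinom_has_sum[OF q norms(4), of "b * q ^ r"] by (simp add: B_def mult_ac)
  have sG: "((\<lambda>m. qbinom_coeff q 0 m * (l2 * l4 * q ^ r) ^ m) has_sum G r) UNIV" for r
  proof -
    have "qpoch_inf 0 q = 1"
      by (simp add: qpoch_inf_def)
    with qbinom_has_sum[OF q le_less_trans[OF norm_mult_power_q_le[OF q] norms(3)], of 0 r]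
    show ?thesis by (simp add: G_def)
  qed
  have "(quad_term has_sum infsum quad_term UNIV) (UNIV \<times> UNIV)"
    using has_sum_infsum[OF quad_term_summable] by simp
  then have "((\<lambda>((r, m), k). c r * (qbinom_coeff q 0 m * (l2 * l4 * q ^ r) ^ m) *
      (qbinom_coeff q (a * q ^ r) k * (l1 * l4) ^ k) * B r) has_sum infsum quad_term UNIV) UNIV"
    by (rule has_sum_SigmaD) (auto simp: split intro!: has_sum_cmult_right sB)
  \<comment> \<open>Writing \<open>UNIV\<close> as a product makes \<open>has_sum_SigmaD\<close>
    applicable again.\<close>
  then have "((\<lambda>((r, m), k). c r * (qbinom_coeff q 0 m * (l2 * l4 * q ^ r) ^ m) *
      (qbinom_coeff q (a * q ^ r) k * (l1 * l4) ^ k) * B r) has_sum infsum quad_term UNIV) (UNIV \<times> UNIV)"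
    by simp
  then have "((\<lambda>(r, m). c r * (qbinom_coeff q 0 m * (l2 * l4 * q ^ r) ^ m) * A r * B r)
      has_sum infsum quad_term UNIV) UNIV"
    by (rule has_sum_SigmaD) (auto intro!: has_sum_cmult_right has_sum_cmult_left sA)
  then have "((\<lambda>(r, m). c r * (qbinom_coeff q 0 m * (l2 * l4 * q ^ r) ^ m) * A r * B r)
      has_sum infsum quad_term UNIV) (UNIV \<times> UNIV)"
    by simp
  then have "((\<lambda>r. c r * G r * A r * B r) has_sum infsum quad_term UNIV) UNIV"
    by (rule has_sum_SigmaD) (auto intro!: has_sum_cmult_right has_sum_cmult_left sG)
  then show ?thesis
    by (simp add: c_def A_def B_def G_def divide_inverse mult_ac)
qed

section \<open>Regrouping the quadruple series by n\<close>

text \<open>This is \<Phi>_n(a l1; l1, l2) / (q;q)_n; \<open>psi_coeff\<close> is \<Phi>_n(b l5; l4,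
  l5) / (q;q)_n.\<close>

definition phi_coeff :: "nat \<Rightarrow> complex" where
  "phi_coeff n = (\<Sum>k\<le>n. qpoch a q k * l1 ^ k * l2 ^ (n - k) / (qpoch q q k * qpoch q q (n - k)))"

definition psi_coeff :: "nat \<Rightarrow> complex" where
  "psi_coeff n = (\<Sum>j\<le>n. qpoch b q j * l5 ^ j * l4 ^ (n - j) / (qpoch q q j * qpoch q q (n - j)))"

definition level_set :: "nat \<Rightarrow> (nat \<times> nat \<times> nat) set" where
  "level_set n = (SIGMA k:{..n}. SIGMA j:{..n}. {r. r \<le> k \<and> r \<le> j \<and> k + j \<le> n + r})"

definition quad_index :: "nat \<times> nat \<times> nat \<times> nat \<Rightarrow> ((nat \<times> nat) \<times> nat) \<times> nat" where
  "quad_index = (\<lambda>(n, k, j, r). (((r, n + r - k - j), k - r), j - r))"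

text \<open>For fixed k and j, summing over r undoes the linearisation in
  \<open>qbinomial_product\<close>; the sums over k and j then separate.\<close>

lemma sum_level_set:
  "(\<Sum>x\<in>level_set n. quad_term (quad_index (n, x))) = qpoch q q n * (phi_coeff n * psi_coeff n)"
proof -
  let ?R = "\<lambda>k j. {r. r \<le> k \<and> r \<le> j \<and> k + j \<le> n + r}"
  have "(\<Sum>x\<in>level_set n. quad_term (quad_index (n, x))) =
    (\<Sum>k\<le>n. \<Sum>j\<le>n. \<Sum>r\<in>?R k j. quad_term (quad_index (n, k, j, r)))"
    by (simp add: level_set_def sum.Sigma)
  also have "\<dots> = (\<Sum>k\<le>n. \<Sum>j\<le>n. qpoch q q n *
     ((qpoch a q k * l1 ^ k * l2 ^ (n - k) / (qpoch q q k * qpoch q q (n - k))) *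
      (qpoch b q j * l5 ^ j * l4 ^ (n - j) / (qpoch q q j * qpoch q q (n - j)))))"
  proof (intro sum.cong refl)
    fix k j assume kj: "k \<in> {..n}" "j \<in> {..n}"
    let ?c = "qpoch a q k * qpoch b q j * l1 ^ k * l5 ^ j * l2 ^ (n - k) * l4 ^ (n - j)"
    have "(\<Sum>r\<in>?R k j. quad_term (quad_index (n, k, j, r))) =
      (\<Sum>r\<in>?R k j. ?c * (q ^ (r * (n + r - k - j)) /
        (qpoch q q r * qpoch q q (k - r) * qpoch q q (j - r) * qpoch q q (n + r - k - j))))"
    proof (intro sum.cong refl)
      fix r assume "r \<in> ?R k j"
      then have "k - r + r = k" "j - r + r = j" "n + r - k - j + (j - r) = n - k"
        "n + r - k - j + (k - r) = n - j"
        by auto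
      then show "quad_term (quad_index (n, k, j, r)) = ?c * (q ^ (r * (n + r - k - j)) /
        (qpoch q q r * qpoch q q (k - r) * qpoch q q (j - r) * qpoch q q (n + r - k - j)))"
        by (simp add: quad_term_def quad_index_def)
    qed
    also have "\<dots> = ?c * (qpoch q q n /
        (qpoch q q k * qpoch q q (n - k) * (qpoch q q j * qpoch q q (n - j))))"
      using kj by (subst qbinomial_product[OF q]) (auto simp: sum_distrib_left)
    finally show "(\<Sum>r\<in>?R k j. quad_term (quad_index (n, k, j, r))) = qpoch q q n *
     ((qpoch a q k * l1 ^ k * l2 ^ (n - k) / (qpoch q q k * qpoch q q (n - k))) *
      (qpoch b q j * l5 ^ j * l4 ^ (n - j) / (qpoch q q j * qpoch q q (n - j))))"
      by (simp add: divide_inverse mult_ac)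
  qed
  also have "\<dots> = qpoch q q n * (phi_coeff n * psi_coeff n)"
    by (simp only: phi_coeff_def psi_coeff_def sum_product) (simp only: sum_distrib_left)
  finally show ?thesis .
qed

lemma quad_sum_left:
  "((\<lambda>n. qpoch q q n * (phi_coeff n * psi_coeff n)) has_sum infsum quad_term UNIV) UNIV"
proof -
  \<comment> \<open>The quadruples (n, k, j, r) allowed by \<open>level_set\<close> correspond
    bijectively to all index quadruples; the inverse recovers n as r + m + k + j.\<close>
  have "((\<lambda>x. quad_term (quad_index x)) has_sum infsum quad_term UNIV) (Sigma UNIV level_set) \<longleftrightarrow>
    (quad_term has_sum infsum quad_term UNIV) UNIV"
    by (rule has_sum_reindex_bij_witness[where
          i = "\<lambda>(((r, m), k), j). (r + m + k + j, k + r, j + r, r)" and j = quad_index])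
       (auto simp: quad_index_def level_set_def)
  then have "((\<lambda>x. quad_term (quad_index x)) has_sum infsum quad_term UNIV) (Sigma UNIV level_set)"
    using has_sum_infsum[OF quad_term_summable] by simp
  then show ?thesis
  proof (rule has_sum_SigmaD)
    have "finite (level_set n)" for n
      unfolding level_set_def by (intro finite_SigmaI) auto
    then show "((\<lambda>x. quad_term (quad_index (n, x))) has_sum
        qpoch q q n * (phi_coeff n * psi_coeff n)) (level_set n)" for n
      by (intro has_sum_finiteI) (simp_all only: sum_level_set)
  qed
qed

end

section \<open>Comparison of the two evaluations\<close>

theorem theorem4p3:
  fixes q l1 l2 l3 l4 l5 :: complex
  assumes "0 < norm q" and "norm q < 1"
    and "norm (l1 * l4) < 1" and "norm (l1 * l5) < 1"
    and "norm (l2 * l4) < 1" and "norm (l2 * l5) < 1"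
    and "l1 * l2 * l3 * l4 \<notin> {q powi (- int j) | j. True}"
    and "l2 * l3 * l4 * l5 \<notin> {q powi (- int j) | j. True}"
  shows "summable (phi32_term (l2 * l3) (l2 * l4) (l3 * l4)
           (l1 * l2 * l3 * l4) (l2 * l3 * l4 * l5) q (l1 * l5)) \<and>
    summable (\<lambda>n. al_salam_carlitz q [l1 * l2 * l3] [l1, l2] n *
                  al_salam_carlitz q [l3 * l4 * l5] [l4, l5] n / qpoch q q n) \<and>
    phi32 (l2 * l3) (l2 * l4) (l3 * l4)
      (l1 * l2 * l3 * l4) (l2 * l3 * l4 * l5) q (l1 * l5) =
    qpochs_inf [l1 * l4, l2 * l4, l2 * l5] q /
    qpochs_inf [l1 * l2 * l3 * l4, l2 * l3 * l4 * l5] q *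
    (\<Sum>n. al_salam_carlitz q [l1 * l2 * l3] [l1, l2] n *
          al_salam_carlitz q [l3 * l4 * l5] [l4, l5] n / qpoch q q n)"
proof -
  note q = assms(2)
  define d where "d = l1 * l2 * l3 * l4"
  define e where "e = l2 * l3 * l4 * l5"
  \<comment> \<open>With these values a l1 l4 and b l2 l5 become \<open>d\<close> and
    \<open>e\<close>, the lower parameters of the 3phi2 series.\<close>
  interpret mehler_sum q "l2 * l3" "l3 * l4" l1 l2 l4 l5
    using assms by unfold_locales
  define S where "S = infsum quad_term UNIV"
  let ?s = "\<lambda>n. al_salam_carlitz q [l1 * l2 * l3] [l1, l2] n *
    al_salam_carlitz q [l3 * l4 * l5] [l4, l5] n / qpoch q q n"
  let ?t = "phi32_term (l2 * l3) (l2 * l4) (l3 * l4) d e q (l1 * l5)"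
  let ?Q = "\<lambda>x. qpoch_inf x q"
  have phi: "al_salam_carlitz q [l1 * l2 * l3] [l1, l2] n = qpoch q q n * phi_coeff n" for n
    using al_salam_carlitz_eq[OF q, of "l2 * l3" l1 l2 n]
    by (simp add: al_salam_carlitz_def al_salam_carlitz_gf_def phi_coeff_def mult_ac)
  \<comment> \<open>\<open>l5\<close> comes before \<open>l4\<close> because the numerator parameter
    is b l5.\<close>
  have psi: "al_salam_carlitz q [l3 * l4 * l5] [l4, l5] n = qpoch q q n * psi_coeff n" for n
    using al_salam_carlitz_eq[OF q, of "l3 * l4" l5 l4 n]
    by (simp add: al_salam_carlitz_def al_salam_carlitz_gf_def psi_coeff_def mult_ac)
  have "?s = (\<lambda>n. qpoch q q n * (phi_coeff n * psi_coeff n))"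
    using qpoch_q_nonzero[OF q] by (auto simp: phi psi)
  then have s: "?s sums S"
    using has_sum_imp_sums[OF quad_sum_left] by (simp add: S_def)
  have nz: "x * q ^ n \<noteq> 1" if "x \<notin> {q powi (- int j) | j. True}" for x n
  proof
    assume "x * q ^ n = 1"
    then have "x = q powi (- int n)"
      by (simp add: power_int_minus) (metis inverse_unique mult.commute)
    with that show False by blast
  qed
  have small: "?Q x \<noteq> 0" if "norm x < 1" for x
    by (intro qpoch_inf_nonzero mult_power_neq_1 q that)
  have dQ: "?Q d \<noteq> 0"
    unfolding d_def by (intro qpoch_inf_nonzero[OF q] nz assms(7))
  have eQ: "?Q e \<noteq> 0"
    unfolding e_def by (intro qpoch_inf_nonzero[OF q] nz assms(8))
  \<comment> \<open>\<open>K\<close> is the prefactor of the claim. Dividing the 3phi2 terms by it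
    gives the terms of \<open>quad_sum_right\<close>, so their convergence and sum follow
    together.\<close>
  define K where "K = ?Q (l1 * l4) * ?Q (l2 * l4) * ?Q (l2 * l5) / (?Q d * ?Q e)"
  have K0: "K \<noteq> 0"
    using dQ eQ small assms(3,5,6) by (simp add: K_def)
  have "((\<lambda>r. ?t r / K) has_sum S) UNIV"
  proof -
    have "?t r / K = qpoch (l2 * l3) q r * qpoch (l3 * l4) q r / qpoch q q r * (l1 * l5) ^ r *
      (?Q (l2 * l3 * l1 * l4 * q ^ r) * ?Q (l3 * l4 * l2 * l5 * q ^ r) /
       (?Q (l1 * l4) * ?Q (l2 * l5) * ?Q (l2 * l4 * q ^ r)))" for r
    proof -
      have de: "l2 * l3 * l1 * l4 = d" "l3 * l4 * l2 * l5 = e"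
        by (simp_all add: d_def e_def)
      \<comment> \<open>Each nonzero infinite product splits at r into two nonzero factors. The same
        splittings turn the products at \<open>d * q ^ r\<close> and \<open>e * q ^ r\<close> into
        denominators and the one at \<open>l2 * l4 * q ^ r\<close> into a numerator.\<close>
      have "qpoch d q r \<noteq> 0" "qpoch e q r \<noteq> 0" "?Q (d * q ^ r) \<noteq> 0" "?Q (e * q ^ r) \<noteq> 0"
        "qpoch (l2 * l4) q r \<noteq> 0" "?Q (l2 * l4 * q ^ r) \<noteq> 0"
        using dQ eQ small[OF assms(5)] qpoch_inf_split[OF q, of d r] qpoch_inf_split[OF q, of e r]
          qpoch_inf_split[OF q, of "l2 * l4" r] by auto
      then show ?thesis
        unfolding de
        using small[OF assms(3)] small[OF assms(6)] qpoch_q_nonzero[OF q, of r]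
          qpoch_inf_split[OF q, of d r] qpoch_inf_split[OF q, of e r]
          qpoch_inf_split[OF q, of "l2 * l4" r]
        by (simp add: phi32_term_def qpochs_def K_def divide_simps mult_ac)
    qed
    then show ?thesis
      using quad_sum_right by (simp add: S_def)
  qed
  then have "(\<lambda>r. ?t r / K * K) sums (S * K)"
    by (intro sums_mult2 has_sum_imp_sums)
  then have t: "?t sums (S * K)"
    using K0 by simp
  show ?thesis
    unfolding d_def[symmetric] e_def[symmetric]
    using s t by (simp add: sums_iff phi32_def qpochs_inf_def K_def mult_ac)
qed

end
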